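(* Let $T>0$, let $M,A,J\in\mathbb R^{n\times n}$ be the mass, SIPG stiffness and jump matrices of the discontinuous Galerkin space (defined in the context), let $\rho>0$, $N_\varphi\in\mathbb N$, $\varphi_0,\dots,\varphi_{N_\varphi}>0$ and $\tau_1,\dots,\tau_{N_\varphi}>0$, and let $\boldsymbol b\in C([0,T];\mathbb R^{n})$. Then, for any initial data $\boldsymbol{\mathfrak u}(0),\dot{\boldsymbol{\mathfrak u}}(0)\in\mathbb R^n$ and $\boldsymbol z_q(0)=\boldsymbol 0$, $q=1,\dots,N_\varphi$, the semi-discrete system $$\rho M\ddot{\boldsymbol{\mathfrak u}}(t)+\varphi_0A\boldsymbol{\mathfrak u}(t)+\sum_{q=1}^{N_\varphi}A\boldsymbol z_q(t)+J\dot{\boldsymbol{\mathfrak u}}(t)=\boldsymbol b(t),$$ $$\tau_q\dot{\boldsymbol z}_q(t)+\boldsymbol z_q(t)=\tau_q\varphi_q\dot{\boldsymbol{\mathfrak u}}(t),\qquad q=1,\dots,N_\varphi,$$ for the unknowns $\boldsymbol{\mathfrak u},\boldsymbol z_1,\dots,\boldsymbol z_{N_\varphi}:[0,T]\to\mathbb R^n$, admits a unique solution on $[0,T]$.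
   Context: $\Omega\subset\mathbb R^d$ ($d=2,3$) is a bounded polytopic domain whose boundary is decomposed into two disjoint parts $\Gamma_D$ (of positive surface measure) and $\Gamma_N$. $\mathcal E_h$ is a conforming partition of $\Omega$ into triangles or tetrahedra, $\Gamma_h$ the set of its interior edges/faces, $\boldsymbol n_e$ a unit normal to $e$ (outward on $\partial\Omega$; pointing from $E_i$ to $E_j$, $i<j$, on $e\subset E_i\cap E_j$), $|e|$ the measure of $e$. $\boldsymbol{\mathcal D}_k(\mathcal E_h)$ is the space of vector fields on $\Omega$ whose components are polynomials of degree at most $k$ on each element (no continuity across faces), with basis $\boldsymbol\phi_1,\dots,\boldsymbol\phi_n$. On interior $e\subset E_i\cap E_j$, $i<j$: $\{\cdot\}$ is the arithmetic mean of the two traces, $[\boldsymbol v]=\boldsymbol v|_{E_i}-\boldsymbol v|_{E_j}$, $[\boldsymbol v\otimes\boldsymbol n_e]=[\boldsymbol v]\otimes\boldsymbol n_e$. On $e\subset\partial\Omega$: $\{\cdot\}$ is the trace, $[\boldsymbol v]=\boldsymbol v|_e$, $[\boldsymbol v\otimes\boldsymbol n_e]=\boldsymbol v|_e\otimes\boldsymbol n_e$. $\boldsymbol D$ is a constant positive definite fourth-order tensor with $D_{ijkl}=D_{jikl}=D_{ijlk}=D_{klij}$, $\boldsymbol\varepsilon(\boldsymbol v)$ the symmetric gradient. For $\alpha_0,\beta_0>0$, $$J_0^{\alpha_0,\beta_0}(\boldsymbol v,\boldsymbol w)=\sum_{e\subset\Gamma_h\cup\Gamma_D}\frac{\alpha_0}{|e|^{\beta_0}}\int_e[\boldsymbol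 v]\cdot[\boldsymbol w]\,de,$$ $$a(\boldsymbol v,\boldsymbol w)=\sum_{E\in\mathcal E_h}\int_E\boldsymbol D\boldsymbol\varepsilon(\boldsymbol v):\boldsymbol\varepsilon(\boldsymbol w)\,dE-\sum_{e\subset\Gamma_h\cup\Gamma_D}\int_e\{\boldsymbol D\boldsymbol\varepsilon(\boldsymbol v)\}:[\boldsymbol w\otimes\boldsymbol n_e]\,de-\sum_{e\subset\Gamma_h\cup\Gamma_D}\int_e\{\boldsymbol D\boldsymbol\varepsilon(\boldsymbol w)\}:[\boldsymbol v\otimes\boldsymbol n_e]\,de+J_0^{\alpha_0,\beta_0}(\boldsymbol v,\boldsymbol w).$$ The matrices are $M_{ij}=(\boldsymbol\phi_j,\boldsymbol\phi_i)_{\boldsymbol L_2(\Omega)}$, $A_{ij}=a(\boldsymbol\phi_j,\boldsymbol\phi_i)$, $J_{ij}=J_0^{\alpha_0,\beta_0}(\boldsymbol\phi_j,\boldsymbol\phi_i)$. A solution means $\boldsymbol{\mathfrak u}\in C^2([0,T];\mathbb R^n)$, $\boldsymbol z_q\in C^1([0,T];\mathbb R^n)$ satisfying the equations on $[0,T]$ and the initial conditions. *)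

theory Defs
  imports "HOL-Analysis.Analysis"
begin

section \<open>Domain and mesh\<close>

text \<open>
  A domain is a nonempty open connected set. It is polytopic if its closure is a finite union of
  polytopes; the condition \<open>\<Omega> = interior (closure \<Omega>)\<close> excludes slits, so that every boundary face
  lies in exactly one mesh element and has one trace.
\<close>

definition polytopic_domain :: "(real^'d) set \<Rightarrow> bool" where
  "polytopic_domain \<Omega> \<longleftrightarrow> \<Omega> \<noteq> {} \<and> open \<Omega> \<and> connected \<Omega> \<and> bounded \<Omega> \<and>
     \<Omega> = interior (closure \<Omega>) \<and>
     (\<exists>\<P>. finite \<P> \<and> (\<forall>P\<in>\<P>. polytope P) \<and> closure \<Omega> = \<Union>\<P>)"

text \<open>
  The mesh is a list, so that the elements are numbered; the numbering fixes the sign of the jumps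
  and the direction of the normals. Elements are closed \<open>d\<close>-simplices (triangles for \<open>d = 2\<close>,
  tetrahedra for \<open>d = 3\<close>), and by \<^const>\<open>triangulation\<close> any two of them meet in a common face.
\<close>

definition conforming_mesh :: "(real^'d) set \<Rightarrow> (real^'d) set list \<Rightarrow> bool" where
  "conforming_mesh \<Omega> Es \<longleftrightarrow> distinct Es \<and> triangulation (set Es) \<and>
     (\<forall>K\<in>set Es. int CARD('d) simplex K) \<and> closure \<Omega> = \<Union>(set Es)"

definition mesh_faces :: "(real^'d) set list \<Rightarrow> (real^'d) set set" where
  "mesh_faces Es = {e. \<exists>K\<in>set Es. e facet_of K}"

definition boundary_faces :: "(real^'d) set \<Rightarrow> (real^'d) set list \<Rightarrow> (real^'d) set set" where
  "boundary_faces \<Omega> Es = {e \<in> mesh_faces Es. e \<subseteq> frontier \<Omega>}"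

definition interior_faces :: "(real^'d) set \<Rightarrow> (real^'d) set list \<Rightarrow> (real^'d) set set" where
  "interior_faces \<Omega> Es = {e \<in> mesh_faces Es. \<not> e \<subseteq> frontier \<Omega>}"

text \<open>
  The faces contained in \<open>\<Gamma>\<^sub>h \<union> \<Gamma>\<^sub>D\<close>. Faces are closed here, whereas \<open>\<Gamma>\<^sub>D\<close> and \<open>\<Gamma>\<^sub>N\<close> are disjoint and so
  compete for the points of their common relative boundary; hence the relative interior.
\<close>

definition penalty_faces ::
    "(real^'d) set \<Rightarrow> (real^'d) set list \<Rightarrow> (real^'d) set \<Rightarrow> (real^'d) set set" where
  "penalty_faces \<Omega> Es \<Gamma>D =
     interior_faces \<Omega> Es \<union> {e \<in> boundary_faces \<Omega> Es. rel_interior e \<subseteq> \<Gamma>D}"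

text \<open>
  A face \<open>e\<close> is contained in the two elements \<open>E\<^sub>i\<close>, \<open>E\<^sub>j\<close>, \<open>i < j\<close>, if it is interior, and in one
  element if it lies on the boundary.
\<close>

definition first_elem :: "(real^'d) set list \<Rightarrow> (real^'d) set \<Rightarrow> (real^'d) set" where
  "first_elem Es e = Es ! Min {i. i < length Es \<and> e \<subseteq> Es ! i}"

definition second_elem :: "(real^'d) set list \<Rightarrow> (real^'d) set \<Rightarrow> (real^'d) set" where
  "second_elem Es e = Es ! Max {i. i < length Es \<and> e \<subseteq> Es ! i}"

definition outward_normal :: "(real^'d) set \<Rightarrow> (real^'d) set \<Rightarrow> real^'d" where
  "outward_normal K e = (THE \<nu>. norm \<nu> = 1 \<and> (\<forall>x\<in>e. \<forall>y\<in>e. \<nu> \<bullet> (y - x) = 0) \<and>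
     (\<forall>x\<in>e. \<forall>y\<in>K. \<nu> \<bullet> (y - x) \<le> 0))"

text \<open>
  The outward normal of \<open>E\<^sub>i\<close> points from \<open>E\<^sub>i\<close> to \<open>E\<^sub>j\<close> on an interior face, and out of \<open>\<Omega>\<close> on a
  boundary face.
\<close>

definition face_normal :: "(real^'d) set list \<Rightarrow> (real^'d) set \<Rightarrow> real^'d" where
  "face_normal Es e = outward_normal (first_elem Es e) e"


section \<open>Surface measure\<close>

text \<open>
  The \<open>(d-1)\<close>-dimensional Lebesgue measure on the hyperplane \<open>{x. \<nu> \<bullet> x = c}\<close> with \<open>\<bar>\<nu>\<bar> = 1\<close>:
  by Fubini, the surface measure of a set \<open>B\<close> in the hyperplane is the volume of the prism of
  height 1 over \<open>B\<close>.
\<close>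

definition hyperplane_measure :: "real^'d \<Rightarrow> real \<Rightarrow> (real^'d) measure" where
  "hyperplane_measure \<nu> c = completion
     (distr (density lborel (indicator {x. \<bar>\<nu> \<bullet> x - c\<bar> \<le> 1/2})) borel
       (\<lambda>x. x - (\<nu> \<bullet> x - c) *\<^sub>R \<nu>))"

lemma hyperplane_measure_uminus: "hyperplane_measure (- \<nu>) (- c) = hyperplane_measure \<nu> c"
proof -
  have "\<bar>- \<nu> \<bullet> x - - c\<bar> = \<bar>\<nu> \<bullet> x - c\<bar>"
    and "x - (- \<nu> \<bullet> x - - c) *\<^sub>R - \<nu> = x - (\<nu> \<bullet> x - c) *\<^sub>R \<nu>" for x
    by (simp_all add: algebra_simps)
  then show ?thesis
    unfolding hyperplane_measure_def by presburger
qed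

text \<open>
  A face spans a hyperplane, so the choice of \<open>(\<nu>, c)\<close> is unique up to a common sign, which
  does not matter by the preceding lemma.
\<close>

definition surface_measure :: "(real^'d) set \<Rightarrow> (real^'d) measure" where
  "surface_measure e = (case (SOME (\<nu>, c). norm \<nu> = 1 \<and> e \<subseteq> {x. \<nu> \<bullet> x = c}) of
     (\<nu>, c) \<Rightarrow> hyperplane_measure \<nu> c)"

definition face_area :: "(real^'d) set \<Rightarrow> real" where
  "face_area e = measure (surface_measure e) e"

definition boundary_measure ::
    "(real^'d) set \<Rightarrow> (real^'d) set list \<Rightarrow> (real^'d) set \<Rightarrow> ennreal" where
  "boundary_measure \<Omega> Es S = (\<Sum>e\<in>boundary_faces \<Omega> Es. emeasure (surface_measure e) (S \<inter> e))"


section \<open>Broken polynomial vector fields\<close>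

definition poly_fun_deg_le :: "nat \<Rightarrow> (real^'d \<Rightarrow> real) \<Rightarrow> bool" where
  "poly_fun_deg_le k p \<longleftrightarrow> (\<exists>a :: ('d \<Rightarrow> nat) \<Rightarrow> real.
     \<forall>x. p x = (\<Sum>\<alpha> | sum \<alpha> UNIV \<le> k. a \<alpha> * (\<Prod>i\<in>UNIV. (x $ i) ^ \<alpha> i)))"

text \<open>
  Fields in \<open>D\<^sub>k\<close> are determined only up to their values on the (null) set of element boundaries;
  the representative that is 0 off the open elements is chosen. Traces are therefore always
  limits from inside an element.
\<close>

definition dg_space :: "nat \<Rightarrow> (real^'d) set list \<Rightarrow> (real^'d \<Rightarrow> real^'d) set" where
  "dg_space k Es = {v.
     (\<forall>K\<in>set Es. \<forall>i. \<exists>p. poly_fun_deg_le k p \<and> (\<forall>x\<in>interior K. v x $ i = p x)) \<and>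
     (\<forall>x. x \<notin> (\<Union>K\<in>set Es. interior K) \<longrightarrow> v x = 0)}"

definition basis_of :: "(real^'d \<Rightarrow> real^'d) set \<Rightarrow> ('n::finite \<Rightarrow> real^'d \<Rightarrow> real^'d) \<Rightarrow> bool" where
  "basis_of V \<phi> \<longleftrightarrow> range \<phi> \<subseteq> V \<and>
     (\<forall>v\<in>V. \<exists>c :: real^'n. \<forall>x. v x = (\<Sum>j\<in>UNIV. c $ j *\<^sub>R \<phi> j x)) \<and>
     (\<forall>c :: real^'n. (\<forall>x. (\<Sum>j\<in>UNIV. c $ j *\<^sub>R \<phi> j x) = 0) \<longrightarrow> c = 0)"

definition elem_trace :: "(real^'d) set \<Rightarrow> (real^'d \<Rightarrow> 'b::t2_space) \<Rightarrow> real^'d \<Rightarrow> 'b" where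
  "elem_trace K f x = Lim (at x within interior K) f"

definition avg :: "(real^'d) set \<Rightarrow> (real^'d) set list \<Rightarrow> (real^'d) set \<Rightarrow>
    (real^'d \<Rightarrow> 'b::real_normed_vector) \<Rightarrow> real^'d \<Rightarrow> 'b" where
  "avg \<Omega> Es e f x = (if e \<subseteq> frontier \<Omega> then elem_trace (first_elem Es e) f x
     else (1/2) *\<^sub>R (elem_trace (first_elem Es e) f x + elem_trace (second_elem Es e) f x))"

definition jump :: "(real^'d) set \<Rightarrow> (real^'d) set list \<Rightarrow> (real^'d) set \<Rightarrow>
    (real^'d \<Rightarrow> 'b::real_normed_vector) \<Rightarrow> real^'d \<Rightarrow> 'b" where
  "jump \<Omega> Es e f x = (if e \<subseteq> frontier \<Omega> then elem_trace (first_elem Es e) f x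
     else elem_trace (first_elem Es e) f x - elem_trace (second_elem Es e) f x)"


section \<open>Elasticity tensor and SIPG forms\<close>

definition outer_prod :: "real^'d \<Rightarrow> real^'d \<Rightarrow> real^'d^'d" where
  "outer_prod v w = (\<chi> i j. v $ i * w $ j)"

definition sym_grad :: "(real^'d \<Rightarrow> real^'d) \<Rightarrow> real^'d \<Rightarrow> real^'d^'d" where
  "sym_grad v x = (1/2) *\<^sub>R (jacobian v (at x) + transpose (jacobian v (at x)))"

definition tensor_apply :: "('d \<Rightarrow> 'd \<Rightarrow> 'd \<Rightarrow> 'd \<Rightarrow> real) \<Rightarrow> real^'d^'d \<Rightarrow> real^'d^'d" where
  "tensor_apply D \<epsilon> = (\<chi> i j. \<Sum>k\<in>UNIV. \<Sum>l\<in>UNIV. D i j k l * \<epsilon> $ k $ l)"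

text \<open>
  The inner product of \<^typ>\<open>real^'d^'d\<close> is the double contraction \<open>\<sigma> : \<epsilon>\<close>. Because of the minor
  symmetries, positive definiteness refers to symmetric second-order tensors.
\<close>

definition elasticity_tensor :: "('d::finite \<Rightarrow> 'd \<Rightarrow> 'd \<Rightarrow> 'd \<Rightarrow> real) \<Rightarrow> bool" where
  "elasticity_tensor D \<longleftrightarrow>
     (\<forall>i j k l. D i j k l = D j i k l \<and> D i j k l = D i j l k \<and> D i j k l = D k l i j) \<and>
     (\<forall>\<epsilon> :: real^'d^'d. transpose \<epsilon> = \<epsilon> \<and> \<epsilon> \<noteq> 0 \<longrightarrow> tensor_apply D \<epsilon> \<bullet> \<epsilon> > 0)"

definition jump_form :: "(real^'d) set \<Rightarrow> (real^'d) set list \<Rightarrow> (real^'d) set \<Rightarrow> real \<Rightarrow> real \<Rightarrow>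
    (real^'d \<Rightarrow> real^'d) \<Rightarrow> (real^'d \<Rightarrow> real^'d) \<Rightarrow> real" where
  "jump_form \<Omega> Es \<Gamma>D \<alpha>0 \<beta>0 v w =
     (\<Sum>e\<in>penalty_faces \<Omega> Es \<Gamma>D. \<alpha>0 / face_area e powr \<beta>0 *
        (LINT x:e|surface_measure e. jump \<Omega> Es e v x \<bullet> jump \<Omega> Es e w x))"

definition consistency_form :: "(real^'d) set \<Rightarrow> (real^'d) set list \<Rightarrow> (real^'d) set \<Rightarrow>
    ('d \<Rightarrow> 'd \<Rightarrow> 'd \<Rightarrow> 'd \<Rightarrow> real) \<Rightarrow>
    (real^'d \<Rightarrow> real^'d) \<Rightarrow> (real^'d \<Rightarrow> real^'d) \<Rightarrow> real" where
  "consistency_form \<Omega> Es \<Gamma>D D v w =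
     (\<Sum>e\<in>penalty_faces \<Omega> Es \<Gamma>D. LINT x:e|surface_measure e.
        avg \<Omega> Es e (\<lambda>y. tensor_apply D (sym_grad v y)) x \<bullet>
        outer_prod (jump \<Omega> Es e w x) (face_normal Es e))"

definition sipg_form :: "(real^'d) set \<Rightarrow> (real^'d) set list \<Rightarrow> (real^'d) set \<Rightarrow>
    ('d \<Rightarrow> 'd \<Rightarrow> 'd \<Rightarrow> 'd \<Rightarrow> real) \<Rightarrow> real \<Rightarrow> real \<Rightarrow>
    (real^'d \<Rightarrow> real^'d) \<Rightarrow> (real^'d \<Rightarrow> real^'d) \<Rightarrow> real" where
  "sipg_form \<Omega> Es \<Gamma>D D \<alpha>0 \<beta>0 v w =
     (\<Sum>K\<in>set Es. LINT x:interior K|lborel. tensor_apply D (sym_grad v x) \<bullet> sym_grad w x)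
     - consistency_form \<Omega> Es \<Gamma>D D v w - consistency_form \<Omega> Es \<Gamma>D D w v
     + jump_form \<Omega> Es \<Gamma>D \<alpha>0 \<beta>0 v w"

definition mass_matrix ::
    "(real^'d) set \<Rightarrow> ('n \<Rightarrow> real^'d \<Rightarrow> real^'d) \<Rightarrow> real^'n^'n" where
  "mass_matrix \<Omega> \<phi> = (\<chi> i j. LINT x:\<Omega>|lborel. \<phi> j x \<bullet> \<phi> i x)"

definition stiffness_matrix :: "(real^'d) set \<Rightarrow> (real^'d) set list \<Rightarrow> (real^'d) set \<Rightarrow>
    ('d \<Rightarrow> 'd \<Rightarrow> 'd \<Rightarrow> 'd \<Rightarrow> real) \<Rightarrow> real \<Rightarrow> real \<Rightarrow>
    ('n \<Rightarrow> real^'d \<Rightarrow> real^'d) \<Rightarrow> real^'n^'n" where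
  "stiffness_matrix \<Omega> Es \<Gamma>D D \<alpha>0 \<beta>0 \<phi> =
     (\<chi> i j. sipg_form \<Omega> Es \<Gamma>D D \<alpha>0 \<beta>0 (\<phi> j) (\<phi> i))"

definition jump_matrix :: "(real^'d) set \<Rightarrow> (real^'d) set list \<Rightarrow> (real^'d) set \<Rightarrow>
    real \<Rightarrow> real \<Rightarrow> ('n \<Rightarrow> real^'d \<Rightarrow> real^'d) \<Rightarrow> real^'n^'n" where
  "jump_matrix \<Omega> Es \<Gamma>D \<alpha>0 \<beta>0 \<phi> = (\<chi> i j. jump_form \<Omega> Es \<Gamma>D \<alpha>0 \<beta>0 (\<phi> j) (\<phi> i))"


section \<open>The semi-discrete system\<close>

text \<open>
  \<open>u1\<close>, \<open>u2\<close> are the first two derivatives of \<open>u\<close> on \<open>[0, T]\<close> (one-sided at the end points),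
  and \<open>z1 q\<close> is the derivative of \<open>z q\<close>.
\<close>

definition semidiscrete_solution :: "real \<Rightarrow> real^'n^'n \<Rightarrow> real^'n^'n \<Rightarrow> real^'n^'n \<Rightarrow>
    real \<Rightarrow> nat \<Rightarrow> (nat \<Rightarrow> real) \<Rightarrow> (nat \<Rightarrow> real) \<Rightarrow> (real \<Rightarrow> real^'n) \<Rightarrow> real^'n \<Rightarrow> real^'n \<Rightarrow>
    (real \<Rightarrow> real^'n) \<Rightarrow> (nat \<Rightarrow> real \<Rightarrow> real^'n) \<Rightarrow> bool" where
  "semidiscrete_solution T M A J \<rho> N \<phi> \<tau> b u\<^sub>0 v\<^sub>0 u z \<longleftrightarrow> (\<exists>u1 u2 z1.
     (\<forall>t\<in>{0..T}. (u has_vector_derivative u1 t) (at t within {0..T})) \<and>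
     (\<forall>t\<in>{0..T}. (u1 has_vector_derivative u2 t) (at t within {0..T})) \<and>
     continuous_on {0..T} u2 \<and>
     (\<forall>q\<in>{1..N}. (\<forall>t\<in>{0..T}. (z q has_vector_derivative z1 q t) (at t within {0..T})) \<and>
        continuous_on {0..T} (z1 q)) \<and>
     (\<forall>t\<in>{0..T}. \<rho> *\<^sub>R (M *v u2 t) + \<phi> 0 *\<^sub>R (A *v u t) + (\<Sum>q=1..N. A *v z q t) + J *v u1 t
        = b t) \<and>
     (\<forall>q\<in>{1..N}. \<forall>t\<in>{0..T}. \<tau> q *\<^sub>R z1 q t + z q t = (\<tau> q * \<phi> q) *\<^sub>R u1 t) \<and>
     u 0 = u\<^sub>0 \<and> u1 0 = v\<^sub>0 \<and> (\<forall>q\<in>{1..N}. z q 0 = 0))"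

end

theory Submission
  imports Defs
begin

text \<open>
  The mass matrix \<open>M\<close> is the Gram matrix of a basis of the discontinuous Galerkin space, hence
  invertible. Integrating the equations for the internal
  variables by variation of constants expresses \<open>z\<^sub>q\<close>, and likewise \<open>u\<close>, as Volterra integral
  operators applied to the velocity \<open>v = u'\<close>. Solving the first equation for \<open>u''\<close> and integrating
  once more turns the system into \<open>v = G v\<close>, and \<open>G\<close> is a contraction for the weighted maximum norm
  \<open>max\<^sub>t exp (- l t) \<parallel>v t\<parallel>\<close> once \<open>l\<close> is large.
\<close>

section \<open>Invertibility of the mass matrix\<close>

lemma continuous_on_poly_fun:
  fixes p :: "real^'d::finite \<Rightarrow> real"
  assumes "poly_fun_deg_le k p"
  shows "continuous_on S p"
proof -
  obtain a where "p = (\<lambda>x. \<Sum>\<alpha> | sum \<alpha> UNIV \<le> k. a \<alpha> * (\<Prod>i\<in>UNIV. (x $ i) ^ \<alpha> i))"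
    using assms unfolding poly_fun_deg_le_def by blast
  then show ?thesis
    by (auto intro!: continuous_intros)
qed

lemma dg_space_continuous_on:
  fixes v :: "real^'d::finite \<Rightarrow> real^'d"
  assumes "v \<in> dg_space k Es" "K \<in> set Es"
  shows "continuous_on (interior K) v"
proof -
  have "continuous_on (interior K) (\<lambda>x. v x $ i)" for i
  proof -
    obtain p where "poly_fun_deg_le k p" "\<forall>x\<in>interior K. v x $ i = p x"
      using assms unfolding dg_space_def by blast
    then show ?thesis
      using continuous_on_poly_fun continuous_on_cong by metis
  qed
  then show ?thesis
    by (simp add: continuous_on_vec_lambda[where f="\<lambda>i x. v x $ i", simplified])
qed

text \<open>The chosen representative vanishes off the open set formed by the element interiors and
  is continuous on it, so it equals its own product with the indicator of that set.\<close>

lemma dg_space_borel_measurable: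
  fixes v :: "real^'d::finite \<Rightarrow> real^'d"
  assumes "v \<in> dg_space k Es"
  shows "v \<in> borel_measurable borel"
proof -
  let ?U = "\<Union>K\<in>set Es. interior K"
  have "continuous_on ?U v"
    using assms by (intro continuous_on_open_UN) (auto intro: dg_space_continuous_on)
  then have "(\<lambda>x. indicator ?U x *\<^sub>R v x) \<in> borel_measurable borel"
    by (intro borel_measurable_continuous_on_indicator borel_open) auto
  also have "(\<lambda>x. indicator ?U x *\<^sub>R v x) = v"
    using assms by (fastforce simp: dg_space_def indicator_def)
  finally show ?thesis .
qed

text \<open>On each element interior every component agrees with a polynomial, which is bounded on
  the compact closed element; there are finitely many elements, and off their interiors the field is
  0.\<close>

lemma dg_space_bounded:
  fixes v :: "real^'d::finite \<Rightarrow> real^'d"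
  assumes v: "v \<in> dg_space k Es" and cpt: "\<And>K. K \<in> set Es \<Longrightarrow> compact K"
  shows "bounded (range v)"
proof -
  have comp: "bounded ((\<lambda>x. v x $ i) ` interior K)" if K: "K \<in> set Es" for K i
  proof -
    obtain p where p: "poly_fun_deg_le k p" "\<forall>x\<in>interior K. v x $ i = p x"
      using v K unfolding dg_space_def by blast
    have "bounded (p ` K)"
      using compact_continuous_image[OF continuous_on_poly_fun[OF p(1)] cpt[OF K]]
      by (rule compact_imp_bounded)
    moreover have "(\<lambda>x. v x $ i) ` interior K \<subseteq> p ` K"
      using p(2) interior_subset by fastforce
    ultimately show ?thesis
      by (rule bounded_subset)
  qed
  have "bounded (v ` interior K)" if K: "K \<in> set Es" for K
  proof -
    obtain B where "\<And>i x. x \<in> interior K \<Longrightarrow> \<bar>v x $ i\<bar> \<le> B i"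
      using comp[OF K] unfolding bounded_iff by simp metis
    then have "norm (v x) \<le> (\<Sum>i\<in>UNIV. B i)" if "x \<in> interior K" for x
      using that by (intro order_trans[OF norm_le_l1_cart] sum_mono)
    then show ?thesis
      unfolding bounded_iff by blast
  qed
  then have "bounded (insert 0 (\<Union>K\<in>set Es. v ` interior K))"
    by (simp add: bounded_UN)
  moreover have "range v \<subseteq> insert 0 (\<Union>K\<in>set Es. v ` interior K)"
    using v unfolding dg_space_def by blast
  ultimately show ?thesis
    by (rule bounded_subset)
qed

lemma dg_space_integrable_inner:
  fixes v w :: "real^'d::finite \<Rightarrow> real^'d"
  assumes "v \<in> dg_space k Es" "w \<in> dg_space k Es" "\<And>K. K \<in> set Es \<Longrightarrow> compact K"
    and \<Omega>: "open \<Omega>" "bounded \<Omega>"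
  shows "set_integrable lborel \<Omega> (\<lambda>x. v x \<bullet> w x)"
proof -
  obtain B C where B: "\<And>x. norm (v x) \<le> B" and C: "\<And>x. norm (w x) \<le> C"
    using dg_space_bounded[OF assms(1,3)] dg_space_bounded[OF assms(2,3)]
    unfolding bounded_iff by auto
  have "\<bar>v x \<bullet> w x\<bar> \<le> B * C" for x
    using Cauchy_Schwarz_ineq2[of "v x" "w x"] mult_mono[OF B[of x] C[of x]]
      norm_ge_zero[of "v x"] B[of x] by (smt (verit) norm_ge_zero)
  moreover have "(\<lambda>x. v x \<bullet> w x) \<in> borel_measurable lborel"
    using dg_space_borel_measurable[OF assms(1)] dg_space_borel_measurable[OF assms(2)] by simp
  ultimately show ?thesis
    unfolding set_integrable_def using \<Omega>
    using emeasure_bounded_finite[OF \<Omega>(2)]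
    by (intro integrableI_bounded_set_indicator[where B="B * C"]) auto
qed

text \<open>Inside an element the field is continuous, so the points where it is nonzero form an
  open set, and a nonempty open set is not null. Off the element interiors the value is 0 by the
  choice of representative. This gives the passage from a vanishing \<open>L2\<close> norm to a
  field that vanishes at every point, as linear independence in \<open>basis_of\<close>
  demands.\<close>

lemma dg_space_AE_zero:
  fixes v :: "real^'d::finite \<Rightarrow> real^'d"
  assumes v: "v \<in> dg_space k Es" and sub: "\<And>K. K \<in> set Es \<Longrightarrow> interior K \<subseteq> \<Omega>"
    and ae: "AE x in lborel. x \<in> \<Omega> \<longrightarrow> v x = 0"
  shows "v x = 0"
proof (rule ccontr)
  assume nz: "v x \<noteq> 0"
  then obtain K where K: "K \<in> set Es" "x \<in> interior K"
    using v unfolding dg_space_def by blast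
  let ?S = "interior K \<inter> v -` (- {0})"
  have "open ?S"
    using dg_space_continuous_on[OF v K(1)] by (intro continuous_open_preimage) auto
  moreover have "AE y \<in> ?S in lebesgue. y \<in> {}"
    using AE_completion[OF ae] by eventually_elim (use sub[OF K(1)] in auto)
  \<comment> \<open>Applied with the empty set as the closed set: a point of the open set
    \<open>?S\<close> would have to lie in it.\<close>
  ultimately show False
    using mem_closed_if_AE_lebesgue_open[of ?S "{}" x] nz K(2) by auto
qed

section \<open>The mass matrix as a Gram matrix\<close>

text \<open>\<open>basis_of\<close> places the basis fields in the space but says nothing about
  their combinations, to which the almost-everywhere argument is applied. On each element the
  monomial coefficients combine linearly.\<close>

lemma dg_space_sum:
  assumes "\<And>j. j \<in> I \<Longrightarrow> \<phi> j \<in> dg_space k Es"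
  shows "(\<lambda>x. \<Sum>j\<in>I. c j *\<^sub>R \<phi> j x) \<in> dg_space k Es"
proof -
  have "\<exists>p. poly_fun_deg_le k p \<and> (\<forall>x\<in>interior K. (\<Sum>j\<in>I. c j *\<^sub>R \<phi> j x) $ i = p x)"
    if K: "K \<in> set Es" for K i
  proof -
    have "\<forall>j\<in>I. \<exists>a. \<forall>x\<in>interior K.
        \<phi> j x $ i = (\<Sum>\<alpha> | sum \<alpha> UNIV \<le> k. a \<alpha> * (\<Prod>i\<in>UNIV. (x $ i) ^ \<alpha> i))"
      using assms(1) K unfolding dg_space_def poly_fun_deg_le_def by fastforce
    from bchoice[OF this] obtain a where a: "\<And>j x. j \<in> I \<Longrightarrow> x \<in> interior K \<Longrightarrow>
        \<phi> j x $ i = (\<Sum>\<alpha> | sum \<alpha> UNIV \<le> k. a j \<alpha> * (\<Prod>i\<in>UNIV. (x $ i) ^ \<alpha> i))"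
      by blast
    let ?p = "\<lambda>x. \<Sum>\<alpha> | sum \<alpha> UNIV \<le> k. (\<Sum>j\<in>I. c j * a j \<alpha>) * (\<Prod>i\<in>UNIV. (x $ i) ^ \<alpha> i)"
    have "(\<Sum>j\<in>I. c j *\<^sub>R \<phi> j x) $ i = ?p x" if "x \<in> interior K" for x
    proof -
      have "(\<Sum>j\<in>I. c j *\<^sub>R \<phi> j x) $ i =
          (\<Sum>j\<in>I. \<Sum>\<alpha> | sum \<alpha> UNIV \<le> k. c j * a j \<alpha> * (\<Prod>i\<in>UNIV. (x $ i) ^ \<alpha> i))"
        by (simp add: a[OF _ that] sum_distrib_left mult.assoc)
      also have "\<dots> = ?p x"
        by (subst sum.swap) (simp add: sum_distrib_right)
      finally show ?thesis .
    qed
    then show ?thesis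
      unfolding poly_fun_deg_le_def by (intro exI[of _ ?p] conjI exI[of _ "\<lambda>\<alpha>. \<Sum>j\<in>I. c j * a j \<alpha>"]) auto
  qed
  then show ?thesis
    using assms(1) unfolding dg_space_def by (auto intro!: sum.neutral)
qed

text \<open>Bilinearity of the inner product; integrability of each product lets the integral pass
  through the double sum. It identifies the quadratic form of \<open>M\<close> with a squared
  \<open>L2\<close> norm.\<close>

lemma mass_matrix_quadratic_form:
  fixes \<phi> :: "'n::finite \<Rightarrow> real^'d::finite \<Rightarrow> real^'d" and c :: "real^'n"
  assumes "\<And>i j. set_integrable lborel \<Omega> (\<lambda>x. \<phi> j x \<bullet> \<phi> i x)"
  shows "c \<bullet> (mass_matrix \<Omega> \<phi> *v c) =
    (LINT x:\<Omega>|lborel. (\<Sum>j\<in>UNIV. c $ j *\<^sub>R \<phi> j x) \<bullet> (\<Sum>j\<in>UNIV. c $ j *\<^sub>R \<phi> j x))"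
proof -
  let ?v = "\<lambda>x. \<Sum>j\<in>UNIV. c $ j *\<^sub>R \<phi> j x"
  have "indicator \<Omega> x *\<^sub>R (?v x \<bullet> ?v x) =
      (\<Sum>i\<in>UNIV. \<Sum>j\<in>UNIV. c $ i * c $ j * (indicator \<Omega> x *\<^sub>R (\<phi> j x \<bullet> \<phi> i x)))" for x
    by (simp only: inner_sum_left inner_sum_right scaleR_sum_right)
      (intro sum.cong refl, simp add: inner_commute)
  then have "(LINT x:\<Omega>|lborel. ?v x \<bullet> ?v x) = (LINT x|lborel.
      (\<Sum>i\<in>UNIV. \<Sum>j\<in>UNIV. c $ i * c $ j * (indicator \<Omega> x *\<^sub>R (\<phi> j x \<bullet> \<phi> i x))))"
    unfolding set_lebesgue_integral_def by simp
  also have "\<dots> = (\<Sum>i\<in>UNIV. \<Sum>j\<in>UNIV. c $ i * c $ j * (LINT x:\<Omega>|lborel. \<phi> j x \<bullet> \<phi> i x))"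
    using assms unfolding set_lebesgue_integral_def set_integrable_def
    by (simp add: Bochner_Integration.integral_sum)
  also have "\<dots> = c \<bullet> (mass_matrix \<Omega> \<phi> *v c)"
    by (simp add: inner_vec_def matrix_vector_mult_def mass_matrix_def sum_distrib_left mult.assoc
        mult.commute[of "LINT x:\<Omega>|lborel. _ x"])
  finally show ?thesis ..
qed

text \<open>A kernel vector \<open>c\<close> gives a field with zero \<open>L2\<close> norm, hence
  the zero field, hence \<open>c = 0\<close> by linear independence; a square matrix with trivial
  kernel is invertible.\<close>

lemma mass_matrix_invertible:
  fixes \<phi> :: "'n::finite \<Rightarrow> real^'d::finite \<Rightarrow> real^'d"
  assumes dom: "polytopic_domain \<Omega>" and mesh: "conforming_mesh \<Omega> Es"
    and basis: "basis_of (dg_space k Es) \<phi>"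
  shows "invertible (mass_matrix \<Omega> \<phi>)"
proof -
  have \<phi>: "\<phi> j \<in> dg_space k Es" for j
    using basis unfolding basis_of_def by blast
  have cpt: "compact K" if "K \<in> set Es" for K
    using that mesh unfolding conforming_mesh_def
    by (blast intro: compact_simplex)
  have \<Omega>: "open \<Omega>" "bounded \<Omega>" "\<Omega> = interior (closure \<Omega>)"
    using dom unfolding polytopic_domain_def by blast+
  \<comment> \<open>The condition \<open>\<Omega> = interior (closure \<Omega>)\<close> is what
    keeps element interiors inside the domain.\<close>
  have sub: "interior K \<subseteq> \<Omega>" if "K \<in> set Es" for K
    using that mesh \<Omega>(3) interior_mono[of K "closure \<Omega>"] unfolding conforming_mesh_def by blast
  have "c = 0" if Mc: "mass_matrix \<Omega> \<phi> *v c = 0" for c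
  proof -
    define v where "v x = (\<Sum>j\<in>UNIV. c $ j *\<^sub>R \<phi> j x)" for x
    have v: "v \<in> dg_space k Es"
      unfolding v_def by (intro dg_space_sum \<phi>)
    have int: "set_integrable lborel \<Omega> (\<lambda>x. w x \<bullet> w' x)"
      if "w \<in> dg_space k Es" "w' \<in> dg_space k Es" for w w'
      using dg_space_integrable_inner[OF that cpt] \<Omega> by blast
    have "(LINT x:\<Omega>|lborel. v x \<bullet> v x) = 0"
      using mass_matrix_quadratic_form[of \<Omega> \<phi> c] int \<phi> Mc by (simp add: v_def)
    then have "AE x in lborel. indicator \<Omega> x *\<^sub>R (v x \<bullet> v x) = 0"
      using int[OF v v] unfolding set_lebesgue_integral_def set_integrable_def
      by (subst (asm) integral_nonneg_eq_0_iff_AE) auto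
    then have "AE x in lborel. x \<in> \<Omega> \<longrightarrow> v x = 0"
      by eventually_elim auto
    then have "v x = 0" for x
      using dg_space_AE_zero[OF v sub] by blast
    then show ?thesis
      using basis unfolding basis_of_def v_def by blast
  qed
  then show ?thesis
    using matrix_left_invertible_ker[of "mass_matrix \<Omega> \<phi>"] matrix_left_right_inverse
    unfolding invertible_def by blast
qed


section \<open>Volterra fixed points\<close>

text \<open>Conjugation with the weight \<open>exp (l * t)\<close> turns \<open>contr\<close> into a
  Lipschitz bound 1/2 in the supremum norm, so Banach's theorem applies. The hypothesis speaks of a
  pointwise bound \<open>m\<close> instead of a weighted norm, so that it can be checked by
  estimating integrals and serves directly in the uniqueness part.\<close>

lemma weighted_contraction_fixed_point:
  fixes G :: "(real \<Rightarrow> 'a::banach) \<Rightarrow> real \<Rightarrow> 'a"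
  assumes T: "T \<ge> 0"
    and cont: "\<And>v. continuous_on {0..T} v \<Longrightarrow> continuous_on {0..T} (G v)"
    and contr: "\<And>v w m t. \<lbrakk>continuous_on {0..T} v; continuous_on {0..T} w;
      \<And>s. s \<in> {0..T} \<Longrightarrow> norm (v s - w s) \<le> m * exp (l * s); t \<in> {0..T}\<rbrakk>
      \<Longrightarrow> norm (G v t - G w t) \<le> m / 2 * exp (l * t)"
  obtains v where "continuous_on {0..T} v" "\<And>t. t \<in> {0..T} \<Longrightarrow> G v t = v t"
    "\<And>w t. \<lbrakk>continuous_on {0..T} w; \<And>t. t \<in> {0..T} \<Longrightarrow> G w t = w t; t \<in> {0..T}\<rbrakk> \<Longrightarrow> w t = v t"
proof -
  \<comment> \<open>The complete space at hand consists of bounded continuous functions on the whole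
    line; clamping the argument to \<open>{0..T}\<close> extends functions from the interval to such
    functions.\<close>
  define c where "c t = max 0 (min T t)" for t :: real
  have c: "c t \<in> {0..T}" "t \<in> {0..T} \<Longrightarrow> c t = t" for t
    using T by (auto simp: c_def)
  have c_cont: "continuous_on UNIV c"
    unfolding c_def by (intro continuous_intros)
  \<comment> \<open>\<open>E\<close> removes the weight and \<open>F\<close> is \<open>G\<close>
    seen through it, so a fixed point \<open>w\<close> of \<open>F\<close> yields the fixed point
    \<open>E w\<close> of \<open>G\<close> on \<open>{0..T}\<close>.\<close>
  define E where "E w s = exp (l * s) *\<^sub>R apply_bcontfun w s" for w :: "real \<Rightarrow>\<^sub>C 'a" and s
  have E_cont: "continuous_on S (E w)" for S w
    unfolding E_def by (intro continuous_intros) auto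
  define F where "F w t = exp (- l * c t) *\<^sub>R G (E w) (c t)" for w t
  have F: "F w \<in> bcontfun" for w
  proof -
    have g: "continuous_on {0..T} (\<lambda>s. exp (- l * s) *\<^sub>R G (E w) s)"
      by (intro continuous_intros cont E_cont)
    have "bounded ((\<lambda>s. exp (- l * s) *\<^sub>R G (E w) s) ` {0..T})"
      using compact_continuous_image[OF g] by (simp add: compact_imp_bounded)
    then have "bounded (range (F w))"
      by (rule bounded_subset) (use c(1) in \<open>auto simp: F_def intro!: image_eqI\<close>)
    moreover have "continuous_on UNIV (F w)"
      unfolding F_def using continuous_on_compose2[OF g c_cont] c(1) by blast
    ultimately show ?thesis
      by (simp add: bcontfun_def)
  qed
  have "dist (Bcontfun (F w)) (Bcontfun (F w')) \<le> 1/2 * dist w w'" for w w'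
  proof (rule dist_bound)
    fix t
    have "norm (E w s - E w' s) \<le> dist w w' * exp (l * s)" for s
      using dist_bounded[of w s w'] unfolding E_def
      by (simp add: dist_norm scaleR_diff_right[symmetric] mult.commute)
    then have "norm (G (E w) (c t) - G (E w') (c t)) \<le> dist w w' / 2 * exp (l * c t)"
      by (intro contr E_cont c(1))
    then have "exp (- l * c t) * norm (G (E w) (c t) - G (E w') (c t)) \<le> dist w w' / 2"
      by (simp add: exp_minus field_simps)
    then show "dist (apply_bcontfun (Bcontfun (F w)) t) (apply_bcontfun (Bcontfun (F w')) t)
        \<le> 1/2 * dist w w'"
      by (simp add: Bcontfun_inverse[OF F] F_def dist_norm scaleR_diff_right[symmetric])
  qed
  then obtain w where w: "Bcontfun (F w) = w"
    using banach_fix_type[of "1/2" "\<lambda>w. Bcontfun (F w)"] by auto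
  have fix1: "G (E w) t = E w t" if "t \<in> {0..T}" for t
  proof -
    have "apply_bcontfun w t = exp (- l * t) *\<^sub>R G (E w) t"
      using Bcontfun_inverse[OF F, of w] c(2)[OF that] by (simp add: w F_def)
    then show ?thesis
      by (simp add: E_def exp_minus)
  qed
  have uniq: "v t = E w t" if v: "continuous_on {0..T} v" "\<And>t. t \<in> {0..T} \<Longrightarrow> G v t = v t"
    and t: "t \<in> {0..T}" for v t
  proof -
    \<comment> \<open>At a maximum point \<open>r\<close> of the weighted distance the contraction
      halves the maximum, so the maximum is at most 0.\<close>
    let ?h = "\<lambda>s. exp (- l * s) * norm (v s - E w s)"
    have "continuous_on {0..T} ?h"
      by (intro continuous_intros v E_cont)
    then obtain r where r: "r \<in> {0..T}" "\<And>s. s \<in> {0..T} \<Longrightarrow> ?h s \<le> ?h r"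
      using continuous_attains_sup[of "{0..T}" ?h] T by auto
    have "norm (v s - E w s) \<le> ?h r * exp (l * s)" if "s \<in> {0..T}" for s
      using r(2)[OF that] by (simp add: exp_minus field_simps)
    then have "norm (G v r - G (E w) r) \<le> ?h r / 2 * exp (l * r)"
      by (intro contr E_cont v r)
    then have "?h r \<le> ?h r / 2"
      using r(1) by (simp add: v fix1 exp_minus field_simps)
    then have "?h t \<le> 0"
      using r(2)[OF t] by linarith
    then show ?thesis
      by (simp add: mult_le_0_iff)
  qed
  show ?thesis
    by (rule that[of "E w"]) (use E_cont fix1 uniq in blast)+
qed

text \<open>Integrating the weight \<open>exp (l * s)\<close> gains a factor \<open>1 / l\<close>:
  this is the source of smallness for large \<open>l\<close>.\<close>

lemma integral_exp_weight_bound: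
  fixes f :: "real \<Rightarrow> 'a::banach"
  assumes l: "l > 0" and t: "t \<in> {0..T}" and f: "continuous_on {0..T} f"
    and le: "\<And>s. s \<in> {0..T} \<Longrightarrow> norm (f s) \<le> m * exp (l * s)"
  shows "norm (integral {0..t} f) \<le> m / l * exp (l * t)"
proof -
  have m: "0 \<le> m"
    using order_trans[OF norm_ge_zero le[of 0]] t by simp
  have I: "((\<lambda>s. m * exp (l * s)) has_integral m / l * exp (l * t) - m / l * exp (l * 0)) {0..t}"
    using l t by (intro fundamental_theorem_of_calculus)
      (auto intro!: derivative_eq_intros simp flip: has_real_derivative_iff_has_vector_derivative)
  have "norm (integral {0..t} f) \<le> integral {0..t} (\<lambda>s. m * exp (l * s))"
    using t le I continuous_on_subset[OF f]
    by (intro integral_norm_bound_integral integrable_continuous_real continuous_intros) auto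
  \<comment> \<open>The contribution \<open>m / l\<close> of the lower end point is dropped; it is
    nonnegative because \<open>m\<close> is.\<close>
  also have "\<dots> \<le> m / l * exp (l * t)"
    using integral_unique[OF I] m l by simp
  finally show ?thesis .
qed

text \<open>The solution of \<open>z' + z / \<tau> = f\<close>, \<open>z 0 = 0\<close>, by variation of constants.\<close>

definition relaxation :: "real \<Rightarrow> (real \<Rightarrow> 'a::banach) \<Rightarrow> real \<Rightarrow> 'a" where
  "relaxation \<tau> f t = exp (- t / \<tau>) *\<^sub>R integral {0..t} (\<lambda>s. exp (s / \<tau>) *\<^sub>R f s)"

lemma relaxation_has_vector_derivative:
  assumes "\<tau> \<noteq> 0" "continuous_on {0..T} f" "t \<in> {0..T}"
  shows "(relaxation \<tau> f has_vector_derivative f t - (1 / \<tau>) *\<^sub>R relaxation \<tau> f t) (at t within {0..T})"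
proof -
  have "((\<lambda>t. exp (- t / \<tau>)) has_real_derivative exp (- t / \<tau>) * (- 1 / \<tau>)) (at t within {0..T})"
    using \<open>\<tau> \<noteq> 0\<close> by (auto intro!: derivative_eq_intros)
  moreover have "((\<lambda>t. integral {0..t} (\<lambda>s. exp (s / \<tau>) *\<^sub>R f s)) has_vector_derivative
      exp (t / \<tau>) *\<^sub>R f t) (at t within {0..T})"
    using assms by (intro integral_has_vector_derivative continuous_intros) auto
  ultimately have "(relaxation \<tau> f has_vector_derivative
      exp (- t / \<tau>) *\<^sub>R exp (t / \<tau>) *\<^sub>R f t +
      (exp (- t / \<tau>) * (- 1 / \<tau>)) *\<^sub>R integral {0..t} (\<lambda>s. exp (s / \<tau>) *\<^sub>R f s)) (at t within {0..T})"
    unfolding relaxation_def[abs_def] by (rule has_vector_derivative_scaleR)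
  then show ?thesis
    by (simp add: relaxation_def exp_minus_inverse mult.commute flip: exp_add)
qed

lemma relaxation_continuous_on:
  assumes "\<tau> \<noteq> 0" "continuous_on {0..T} f"
  shows "continuous_on {0..T} (relaxation \<tau> f)"
  using relaxation_has_vector_derivative[OF assms]
  by (meson continuous_on_eq_continuous_within has_vector_derivative_continuous)

text \<open>With the integrating factor \<open>exp (s / \<tau>)\<close> the derivative of
  \<open>exp (s / \<tau>) *\<^sub>R z s\<close> is \<open>exp (s / \<tau>) *\<^sub>R f s\<close>,
  and the fundamental theorem recovers \<open>z\<close>.\<close>

lemma relaxation_unique:
  fixes z :: "real \<Rightarrow> 'a::banach"
  assumes z: "\<And>s. s \<in> {0..T} \<Longrightarrow>
      (z has_vector_derivative f s - (1 / \<tau>) *\<^sub>R z s) (at s within {0..T})"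
    and "\<tau> \<noteq> 0" "z 0 = 0" and t: "t \<in> {0..T}"
  shows "z t = relaxation \<tau> f t"
proof -
  have "((\<lambda>s. exp (s / \<tau>) *\<^sub>R z s) has_vector_derivative exp (s / \<tau>) *\<^sub>R f s) (at s within {0..t})"
    if "s \<in> {0..t}" for s
  proof -
    have "((\<lambda>s. exp (s / \<tau>)) has_real_derivative exp (s / \<tau>) * (1 / \<tau>)) (at s within {0..t})"
      using \<open>\<tau> \<noteq> 0\<close> by (auto intro!: derivative_eq_intros)
    moreover have "(z has_vector_derivative f s - (1 / \<tau>) *\<^sub>R z s) (at s within {0..t})"
      using that t by (intro has_vector_derivative_within_subset[OF z]) auto
    ultimately show ?thesis
      using has_vector_derivative_scaleR by (fastforce simp: scaleR_diff_right)
  qed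
  then have "((\<lambda>s. exp (s / \<tau>) *\<^sub>R f s) has_integral exp (t / \<tau>) *\<^sub>R z t - exp (0 / \<tau>) *\<^sub>R z 0) {0..t}"
    using t by (intro fundamental_theorem_of_calculus) auto
  then have "integral {0..t} (\<lambda>s. exp (s / \<tau>) *\<^sub>R f s) = exp (t / \<tau>) *\<^sub>R z t"
    using \<open>z 0 = 0\<close> by (simp add: integral_unique)
  then show ?thesis
    by (simp add: relaxation_def flip: exp_add)
qed

text \<open>Inside the integral the factor \<open>exp (s / \<tau>)\<close> raises the rate from
  \<open>l\<close> to \<open>l + 1 / \<tau>\<close>; the prefactor \<open>exp (- t / \<tau>)\<close>
  undoes this shift, and \<open>1 / (l + 1 / \<tau>) \<le> 1 / l\<close>.\<close>

lemma relaxation_exp_weight_bound: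
  fixes f g :: "real \<Rightarrow> 'a::banach"
  assumes "\<tau> > 0" "l > 0" and t: "t \<in> {0..T}"
    and f: "continuous_on {0..T} f" and g: "continuous_on {0..T} g"
    and le: "\<And>s. s \<in> {0..T} \<Longrightarrow> norm (f s - g s) \<le> m * exp (l * s)"
  shows "norm (relaxation \<tau> f t - relaxation \<tau> g t) \<le> m / l * exp (l * t)"
proof -
  have m: "0 \<le> m"
    using order_trans[OF norm_ge_zero le[of 0]] t by simp
  have "(\<lambda>s. exp (s / \<tau>) *\<^sub>R f s) integrable_on {0..t}" "(\<lambda>s. exp (s / \<tau>) *\<^sub>R g s) integrable_on {0..t}"
    using t \<open>\<tau> > 0\<close>
    by (auto intro!: integrable_continuous_real continuous_intros continuous_on_subset[OF f] continuous_on_subset[OF g])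
  then have eq: "relaxation \<tau> f t - relaxation \<tau> g t =
      exp (- t / \<tau>) *\<^sub>R integral {0..t} (\<lambda>s. exp (s / \<tau>) *\<^sub>R (f s - g s))"
    by (simp add: relaxation_def scaleR_diff_right Henstock_Kurzweil_Integration.integral_diff)
  have "norm (integral {0..t} (\<lambda>s. exp (s / \<tau>) *\<^sub>R (f s - g s)))
      \<le> m / (l + 1 / \<tau>) * exp ((l + 1 / \<tau>) * t)"
  proof (rule integral_exp_weight_bound[OF _ t])
    show "norm (exp (s / \<tau>) *\<^sub>R (f s - g s)) \<le> m * exp ((l + 1 / \<tau>) * s)" if "s \<in> {0..T}" for s
    proof -
      have "exp ((l + 1 / \<tau>) * s) = exp (s / \<tau>) * exp (l * s)"
        by (simp add: distrib_right add.commute flip: exp_add)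
      then show ?thesis
        using mult_left_mono[OF le[OF that], of "exp (s / \<tau>)"] by (simp add: mult.left_commute)
    qed
  qed (use assms in \<open>auto intro!: continuous_intros add_pos_pos\<close>)
  also have "\<dots> \<le> m / l * exp ((l + 1 / \<tau>) * t)"
    using m assms by (intro mult_right_mono divide_left_mono mult_pos_pos add_pos_pos) auto
  also have "\<dots> = exp (t / \<tau>) * (m / l * exp (l * t))"
    by (simp add: exp_add distrib_right)
  finally show ?thesis
    unfolding eq by (simp add: exp_minus field_simps)
qed

section \<open>Well-posedness\<close>

text \<open>The differential equation for abstract matrices; the discontinuous Galerkin space enters
  through \<open>invertible M\<close>. Uniqueness is asserted on \<open>{0..T}\<close> and for
  indices in \<open>{1..N}\<close>, since the functions are total and unconstrained
  elsewhere.\<close>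

theorem semidiscrete_system_well_posed:
  fixes M A J :: "real^'n^'n" and b :: "real \<Rightarrow> real^'n"
  assumes M: "invertible M" and T: "T \<ge> 0" and \<rho>: "\<rho> \<noteq> 0"
    and \<tau>: "\<And>q. q \<in> {1..N} \<Longrightarrow> \<tau> q > 0" and b: "continuous_on {0..T} b"
  shows "\<exists>u z. semidiscrete_solution T M A J \<rho> N \<phi> \<tau> b u\<^sub>0 v\<^sub>0 u z \<and>
    (\<forall>u' z'. semidiscrete_solution T M A J \<rho> N \<phi> \<tau> b u\<^sub>0 v\<^sub>0 u' z' \<longrightarrow>
      (\<forall>t\<in>{0..T}. u' t = u t \<and> (\<forall>q\<in>{1..N}. z' q t = z q t)))"
proof -
  obtain M' where M': "M ** M' = mat 1" "M' ** M = mat 1"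
    using M unfolding invertible_def by blast
  have MM': "M *v (M' *v x) = x" "M' *v (M *v x) = x" for x
    using M' by (simp_all add: matrix_vector_mul_assoc)
  \<comment> \<open>For a velocity \<open>v\<close>, \<open>U v\<close> and \<open>Z v\<close> are
    the displacement and internal variables it generates, \<open>R v\<close> is the acceleration
    that the first equation then dictates, and \<open>G v\<close> is the velocity obtained by
    integrating \<open>R v\<close>.\<close>
  define U where "U v t = u\<^sub>0 + integral {0..t} v" for v :: "real \<Rightarrow> real^'n" and t
  define Z where "Z v q = relaxation (\<tau> q) (\<lambda>s. \<phi> q *\<^sub>R v s)" for v :: "real \<Rightarrow> real^'n" and q
  define R where "R v t = (1 / \<rho>) *\<^sub>R
    (M' *v (b t - \<phi> 0 *\<^sub>R (A *v U v t) - (\<Sum>q=1..N. A *v Z v q t) - J *v v t))" for v t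
  define G where "G v t = v\<^sub>0 + integral {0..t} (R v)" for v t
  have mv: "continuous_on S f \<Longrightarrow> continuous_on S (\<lambda>x. B *v f x)"
    for S and f :: "real \<Rightarrow> real^'n" and B :: "real^'n^'n"
    by (rule bounded_linear.continuous_on[OF matrix_vector_mul_bounded_linear])
  have U_deriv: "(U v has_vector_derivative v t) (at t within {0..T})"
    if "continuous_on {0..T} v" "t \<in> {0..T}" for v t
    unfolding U_def using integral_has_vector_derivative[OF that] by (auto intro!: derivative_eq_intros)
  have U_cont: "continuous_on {0..T} (U v)" if "continuous_on {0..T} v" for v
    using that unfolding U_def
    by (intro continuous_intros indefinite_integral_continuous_1 integrable_continuous_real)
  have Z_deriv: "(Z v q has_vector_derivative \<phi> q *\<^sub>R v t - (1 / \<tau> q) *\<^sub>R Z v q t) (at t within {0..T})"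
    if "q \<in> {1..N}" "continuous_on {0..T} v" "t \<in> {0..T}" for v q t
    unfolding Z_def using that \<tau>[OF that(1)]
    by (intro relaxation_has_vector_derivative continuous_intros) auto
  have Z_cont: "continuous_on {0..T} (Z v q)" if "q \<in> {1..N}" "continuous_on {0..T} v" for v q
    unfolding Z_def using that \<tau>[OF that(1)] by (intro relaxation_continuous_on continuous_intros) auto
  have R_cont: "continuous_on {0..T} (R v)" if "continuous_on {0..T} v" for v
    unfolding R_def using that by (intro continuous_intros mv b U_cont Z_cont)
  \<comment> \<open>The backward direction serves existence, the forward direction
    uniqueness.\<close>
  have R_eq: "\<rho> *\<^sub>R (M *v a) + \<phi> 0 *\<^sub>R (A *v U v t) + (\<Sum>q=1..N. A *v Z v q t) + J *v v t = b t
      \<longleftrightarrow> a = R v t" for a v t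
  proof
    assume "\<rho> *\<^sub>R (M *v a) + \<phi> 0 *\<^sub>R (A *v U v t) + (\<Sum>q=1..N. A *v Z v q t) + J *v v t = b t"
    then have "b t - \<phi> 0 *\<^sub>R (A *v U v t) - (\<Sum>q=1..N. A *v Z v q t) - J *v v t = \<rho> *\<^sub>R (M *v a)"
      by (simp add: algebra_simps)
    then show "a = R v t"
      using \<rho> by (simp add: R_def matrix_vector_mult_scaleR MM')
  next
    assume "a = R v t"
    then show "\<rho> *\<^sub>R (M *v a) + \<phi> 0 *\<^sub>R (A *v U v t) + (\<Sum>q=1..N. A *v Z v q t) + J *v v t = b t"
      using \<rho> by (simp add: R_def matrix_vector_mult_scaleR MM')
  qed
  have G_cont: "continuous_on {0..T} (G v)" if "continuous_on {0..T} v" for v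
    unfolding G_def using that
    by (intro continuous_intros indefinite_integral_continuous_1 integrable_continuous_real R_cont)
  have int: "v integrable_on {0..t}" if "continuous_on {0..T} v" "t \<in> {0..T}"
    for v :: "real \<Rightarrow> real^'n" and t
    using that by (intro integrable_continuous_real continuous_on_subset[OF that(1)]) auto

  have "\<exists>K\<ge>0. \<forall>x. norm (B *v x) \<le> K * norm x" for B :: "real^'n^'n"
    using bounded_linear.nonneg_bounded[OF matrix_vector_mul_bounded_linear[of B]] by (metis mult.commute)
  then obtain K where K: "\<And>B. K B \<ge> 0" "\<And>(B :: real^'n^'n) x. norm (B *v x) \<le> K B * norm x"
    by metis
  \<comment> \<open>A Lipschitz constant of \<open>R\<close> in the weighted norm, collected from
    the operator bounds \<open>K\<close> of the matrices.\<close>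
  define C where "C = K M' / \<bar>\<rho>\<bar> * (\<bar>\<phi> 0\<bar> * K A + (\<Sum>q=1..N. K A * \<bar>\<phi> q\<bar>) + K J)"
  have C: "C \<ge> 0"
    unfolding C_def by (intro mult_nonneg_nonneg add_nonneg_nonneg divide_nonneg_nonneg sum_nonneg K) auto
  \<comment> \<open>Chosen to make both \<open>l \<ge> 1\<close> and
    \<open>C / l \<le> 1 / 2\<close> true.\<close>
  define l where "l = 2 * C + 1"
  have l: "l \<ge> 1" "C / l \<le> 1 / 2"
    using C by (auto simp: l_def field_simps)
  have contr: "norm (G v t - G w t) \<le> m / 2 * exp (l * t)"
    if v: "continuous_on {0..T} v" and w: "continuous_on {0..T} w"
      and le: "\<And>s. s \<in> {0..T} \<Longrightarrow> norm (v s - w s) \<le> m * exp (l * s)" and t: "t \<in> {0..T}" for v w m t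
  proof -
    have m: "0 \<le> m"
      using order_trans[OF norm_ge_zero le[of 0]] T by simp
    \<comment> \<open>The gain \<open>1 / l\<close> is given up for \<open>U\<close> and
      \<open>Z\<close>: the damping term with \<open>J\<close> contains no integral and has no such
      gain, so the outer integral in \<open>G\<close> must provide it for all terms anyway.\<close>
    have weaken: "n / l * exp (l * s) \<le> n * exp (l * s)" if "0 \<le> n" for n s
      using that l(1) by (intro mult_right_mono) (auto simp: divide_le_eq mult_le_cancel_left1)
    have Ub: "norm (U v s - U w s) \<le> m * exp (l * s)" if s: "s \<in> {0..T}" for s
    proof -
      have "U v s - U w s = integral {0..s} (\<lambda>r. v r - w r)"
        using int[OF v s] int[OF w s] by (simp add: U_def Henstock_Kurzweil_Integration.integral_diff)
      also have "norm \<dots> \<le> m / l * exp (l * s)"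
        using l by (intro integral_exp_weight_bound[OF _ s] continuous_intros v w le) auto
      finally show ?thesis
        using weaken[OF m] by (rule order_trans)
    qed
    have Zb: "norm (Z v q s - Z w q s) \<le> \<bar>\<phi> q\<bar> * m * exp (l * s)"
      if q: "q \<in> {1..N}" and s: "s \<in> {0..T}" for q s
    proof -
      have "norm (\<phi> q *\<^sub>R v r - \<phi> q *\<^sub>R w r) \<le> \<bar>\<phi> q\<bar> * m * exp (l * r)" if "r \<in> {0..T}" for r
        using mult_left_mono[OF le[OF that], of "\<bar>\<phi> q\<bar>"] by (simp add: mult.assoc flip: scaleR_diff_right)
      then have "norm (Z v q s - Z w q s) \<le> \<bar>\<phi> q\<bar> * m / l * exp (l * s)"
        unfolding Z_def using \<tau>[OF q] l
        by (intro relaxation_exp_weight_bound[OF _ _ s] continuous_intros v w) auto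
      then show ?thesis
        using weaken[of "\<bar>\<phi> q\<bar> * m"] m by (meson abs_ge_zero mult_nonneg_nonneg order_trans)
    qed
    have Rb: "norm (R v s - R w s) \<le> C * m * exp (l * s)" if s: "s \<in> {0..T}" for s
    proof -
      let ?e = "m * exp (l * s)"
      \<comment> \<open>The difference of the two brackets in \<open>R\<close>, with opposite sign;
        the load \<open>b\<close> cancels.\<close>
      define r where "r = \<phi> 0 *\<^sub>R (A *v (U v s - U w s)) + (\<Sum>q=1..N. A *v (Z v q s - Z w q s)) + J *v (v s - w s)"
      have "R v s - R w s = - (1 / \<rho>) *\<^sub>R (M' *v r)"
        unfolding R_def r_def
        by (simp add: matrix_vector_mult_diff_distrib matrix_vector_right_distrib sum_subtractf algebra_simps)
      then have "norm (R v s - R w s) \<le> K M' / \<bar>\<rho>\<bar> * norm r"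
        using K(2)[of M' r] by (simp add: divide_right_mono)
      also have "\<dots> \<le> K M' / \<bar>\<rho>\<bar> *
          (\<bar>\<phi> 0\<bar> * (K A * ?e) + (\<Sum>q=1..N. K A * (\<bar>\<phi> q\<bar> * ?e)) + K J * ?e)"
        unfolding r_def
      proof (intro mult_left_mono norm_triangle_le add_mono)
        show "norm (\<phi> 0 *\<^sub>R (A *v (U v s - U w s))) \<le> \<bar>\<phi> 0\<bar> * (K A * ?e)"
          using order_trans[OF K(2) mult_left_mono[OF Ub[OF s] K(1)]] by (simp add: mult_left_mono)
        show "norm (\<Sum>q=1..N. A *v (Z v q s - Z w q s)) \<le> (\<Sum>q=1..N. K A * (\<bar>\<phi> q\<bar> * ?e))"
          using order_trans[OF K(2) mult_left_mono[OF Zb[OF _ s] K(1)]]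
          by (intro order_trans[OF norm_sum] sum_mono) (simp add: mult.assoc)
        show "norm (J *v (v s - w s)) \<le> K J * ?e"
          by (rule order_trans[OF K(2) mult_left_mono[OF le[OF s] K(1)]])
      qed (use K(1) in simp)
      also have "\<dots> = C * ?e"
        unfolding C_def by (simp add: distrib_right sum_distrib_right mult.assoc)
      finally show ?thesis
        by (simp add: mult.assoc)
    qed
    have "G v t - G w t = integral {0..t} (\<lambda>r. R v r - R w r)"
      using int[OF R_cont[OF v] t] int[OF R_cont[OF w] t]
      by (simp add: G_def Henstock_Kurzweil_Integration.integral_diff)
    also have "norm \<dots> \<le> C * m / l * exp (l * t)"
      using l by (intro integral_exp_weight_bound[OF _ t] continuous_intros R_cont v w Rb) auto
    also have "\<dots> \<le> m / 2 * exp (l * t)"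
      using mult_right_mono[OF l(2) m] by (intro mult_right_mono) auto
    finally show ?thesis .
  qed
  obtain v where v: "continuous_on {0..T} v" "\<And>t. t \<in> {0..T} \<Longrightarrow> G v t = v t"
    and v_unique: "\<And>w t. \<lbrakk>continuous_on {0..T} w; \<And>t. t \<in> {0..T} \<Longrightarrow> G w t = w t; t \<in> {0..T}\<rbrakk> \<Longrightarrow> w t = v t"
  proof (rule weighted_contraction_fixed_point[of T G l, OF T G_cont contr])
    fix v
    assume "continuous_on {0..T} v" "\<And>t. t \<in> {0..T} \<Longrightarrow> G v t = v t"
      "\<And>w t. \<lbrakk>continuous_on {0..T} w; \<And>t. t \<in> {0..T} \<Longrightarrow> G w t = w t; t \<in> {0..T}\<rbrakk> \<Longrightarrow> w t = v t"
    then show thesis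
      by (rule that)
  qed

  have "semidiscrete_solution T M A J \<rho> N \<phi> \<tau> b u\<^sub>0 v\<^sub>0 (U v) (Z v)"
    unfolding semidiscrete_solution_def
  \<comment> \<open>The velocity is \<open>v\<close>, the acceleration \<open>R v\<close>, and the
    derivative of each \<open>Z v q\<close> is read off its relaxation equation.\<close>
  proof (rule exI[of _ v], rule exI[of _ "R v"],
      rule exI[of _ "\<lambda>q t. \<phi> q *\<^sub>R v t - (1 / \<tau> q) *\<^sub>R Z v q t"], intro conjI ballI)
    show "(v has_vector_derivative R v t) (at t within {0..T})" if t: "t \<in> {0..T}" for t
    \<comment> \<open>The fixed point is a priori merely continuous; it is differentiable because it
      agrees on \<open>{0..T}\<close> with the integral \<open>G v\<close>.\<close>
    proof (rule has_vector_derivative_transform[OF t])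
      show "(G v has_vector_derivative R v t) (at t within {0..T})"
        unfolding G_def using integral_has_vector_derivative[OF R_cont[OF v(1)] t]
        by (auto intro!: derivative_eq_intros)
    qed (use v(2) in simp)
    show "\<rho> *\<^sub>R (M *v R v t) + \<phi> 0 *\<^sub>R (A *v U v t) + (\<Sum>q=1..N. A *v Z v q t) + J *v v t = b t" for t
      by (rule R_eq[THEN iffD2]) (rule refl)
    show "\<tau> q *\<^sub>R (\<phi> q *\<^sub>R v t - (1 / \<tau> q) *\<^sub>R Z v q t) + Z v q t = (\<tau> q * \<phi> q) *\<^sub>R v t"
      if "q \<in> {1..N}" for q t
      using \<tau>[OF that] by (simp add: scaleR_diff_right)
    show "U v 0 = u\<^sub>0" "\<And>q. Z v q 0 = 0"
      by (simp_all add: U_def Z_def relaxation_def)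
    show "v 0 = v\<^sub>0"
      using v(2)[of 0] T by (simp add: G_def)
  qed (use v(1) in \<open>auto intro!: U_deriv Z_deriv R_cont continuous_intros Z_cont\<close>)
  \<comment> \<open>The velocity \<open>u1\<close> of an arbitrary solution is shown to be a fixed
    point of \<open>G\<close>, hence equal to \<open>v\<close> on \<open>{0..T}\<close>.\<close>
  moreover have "u' t = U v t \<and> (\<forall>q\<in>{1..N}. z' q t = Z v q t)"
    if sol: "semidiscrete_solution T M A J \<rho> N \<phi> \<tau> b u\<^sub>0 v\<^sub>0 u' z'" and t: "t \<in> {0..T}" for u' z' t
  proof -
    obtain u1 u2 z1 where
        u': "\<And>t. t \<in> {0..T} \<Longrightarrow> (u' has_vector_derivative u1 t) (at t within {0..T})"
      and u1: "\<And>t. t \<in> {0..T} \<Longrightarrow> (u1 has_vector_derivative u2 t) (at t within {0..T})"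
      and z': "\<And>q t. q \<in> {1..N} \<Longrightarrow> t \<in> {0..T} \<Longrightarrow> (z' q has_vector_derivative z1 q t) (at t within {0..T})"
      and eq: "\<And>t. t \<in> {0..T} \<Longrightarrow>
        \<rho> *\<^sub>R (M *v u2 t) + \<phi> 0 *\<^sub>R (A *v u' t) + (\<Sum>q=1..N. A *v z' q t) + J *v u1 t = b t"
      and eqz: "\<And>q t. q \<in> {1..N} \<Longrightarrow> t \<in> {0..T} \<Longrightarrow> \<tau> q *\<^sub>R z1 q t + z' q t = (\<tau> q * \<phi> q) *\<^sub>R u1 t"
      and init: "u' 0 = u\<^sub>0" "u1 0 = v\<^sub>0" "\<And>q. q \<in> {1..N} \<Longrightarrow> z' q 0 = 0"
      using sol unfolding semidiscrete_solution_def by blast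
    have FTC: "f 0 + integral {0..s} f' = f s"
      if "\<And>t. t \<in> {0..T} \<Longrightarrow> (f has_vector_derivative f' t) (at t within {0..T})" "s \<in> {0..T}"
      for f f' :: "real \<Rightarrow> real^'n" and s
    proof -
      have "(f' has_integral f s - f 0) {0..s}"
        using that(2) by (intro fundamental_theorem_of_calculus has_vector_derivative_within_subset[OF that(1)]) auto
      then show ?thesis
        by (simp add: integral_unique)
    qed
    have u1_cont: "continuous_on {0..T} u1"
      using u1 by (meson continuous_on_eq_continuous_within has_vector_derivative_continuous)
    have uU: "u' s = U u1 s" if "s \<in> {0..T}" for s
      using FTC[OF u' that] by (simp add: U_def init)
    have zZ: "z' q s = Z u1 q s" if q: "q \<in> {1..N}" and s: "s \<in> {0..T}" for q s
      unfolding Z_def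
    proof (rule relaxation_unique[where z="z' q", OF _ _ init(3)[OF q] s])
      fix r assume r: "r \<in> {0..T}"
      \<comment> \<open>The internal equation is divided by \<open>\<tau> q\<close> to reach the
        normal form with source \<open>\<phi> q *\<^sub>R u1 r\<close>.\<close>
      have "\<tau> q *\<^sub>R z1 q r = \<tau> q *\<^sub>R (\<phi> q *\<^sub>R u1 r - (1 / \<tau> q) *\<^sub>R z' q r)"
        using eqz[OF q r] \<tau>[OF q] by (simp add: scaleR_diff_right eq_diff_eq)
      then have "z1 q r = \<phi> q *\<^sub>R u1 r - (1 / \<tau> q) *\<^sub>R z' q r"
        using \<tau>[OF q] by (subst (asm) scaleR_cancel_left) auto
      then show "(z' q has_vector_derivative \<phi> q *\<^sub>R u1 r - (1 / \<tau> q) *\<^sub>R z' q r) (at r within {0..T})"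
        using z'[OF q r] by simp
    qed (use \<tau>[OF q] in auto)
    have "u2 s = R u1 s" if "s \<in> {0..T}" for s
    proof -
      have "(\<Sum>q=1..N. A *v z' q s) = (\<Sum>q=1..N. A *v Z u1 q s)"
        using zZ[OF _ that] by (intro sum.cong) auto
      then show ?thesis
        using eq[OF that] uU[OF that] by (intro R_eq[THEN iffD1]) simp
    qed
    then have "integral {0..s} u2 = integral {0..s} (R u1)" if "s \<in> {0..T}" for s
      using that by (intro Henstock_Kurzweil_Integration.integral_cong) auto
    then have "G u1 s = u1 s" if "s \<in> {0..T}" for s
      using FTC[OF u1 that] that by (simp add: G_def init)
    then have "u1 s = v s" if "s \<in> {0..T}" for s
      using v_unique[OF u1_cont _ that] by blast
    \<comment> \<open>Both operators see a velocity through its values on \<open>{0..t}\<close>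
      alone, so agreement on \<open>{0..T}\<close> suffices.\<close>
    then have "U u1 t = U v t" "Z u1 q t = Z v q t" for q
      using t unfolding U_def Z_def relaxation_def
      by (auto intro!: arg_cong2[where f=scaleR] Henstock_Kurzweil_Integration.integral_cong)
    then show ?thesis
      using uU[OF t] zZ[OF _ t] by simp
  qed
  ultimately show ?thesis
    by blast
qed

theorem theorem3p2:
  fixes \<Omega> \<Gamma>D \<Gamma>N :: "(real^'d::finite) set"
    and Es :: "(real^'d) set list"
    and D :: "'d \<Rightarrow> 'd \<Rightarrow> 'd \<Rightarrow> 'd \<Rightarrow> real"
    and \<alpha>0 \<beta>0 \<rho> T :: real
    and k N\<phi> :: nat
    and \<Phi> :: "'n::finite \<Rightarrow> real^'d \<Rightarrow> real^'d"
    and \<phi> \<tau> :: "nat \<Rightarrow> real"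
    and b :: "real \<Rightarrow> real^'n"
    and u\<^sub>0 v\<^sub>0 :: "real^'n"
    and M A J :: "real^'n^'n"
  assumes "CARD('d) = 2 \<or> CARD('d) = 3"
    and "polytopic_domain \<Omega>"
    and "conforming_mesh \<Omega> Es"
    and "\<Gamma>D \<union> \<Gamma>N = frontier \<Omega>" and "\<Gamma>D \<inter> \<Gamma>N = {}"
    and "boundary_measure \<Omega> Es \<Gamma>D > 0"
    and "elasticity_tensor D"
    and "\<alpha>0 > 0" and "\<beta>0 > 0"
    and "basis_of (dg_space k Es) \<Phi>"
    and "M = mass_matrix \<Omega> \<Phi>"
    and "A = stiffness_matrix \<Omega> Es \<Gamma>D D \<alpha>0 \<beta>0 \<Phi>"
    and "J = jump_matrix \<Omega> Es \<Gamma>D \<alpha>0 \<beta>0 \<Phi>"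
    and "T > 0" and "\<rho> > 0"
    and "\<And>q. q \<le> N\<phi> \<Longrightarrow> \<phi> q > 0"
    and "\<And>q. q \<in> {1..N\<phi>} \<Longrightarrow> \<tau> q > 0"
    and "continuous_on {0..T} b"
  shows "\<exists>u z. semidiscrete_solution T M A J \<rho> N\<phi> \<phi> \<tau> b u\<^sub>0 v\<^sub>0 u z \<and>
    (\<forall>u' z'. semidiscrete_solution T M A J \<rho> N\<phi> \<phi> \<tau> b u\<^sub>0 v\<^sub>0 u' z' \<longrightarrow>
      (\<forall>t\<in>{0..T}. u' t = u t \<and> (\<forall>q\<in>{1..N\<phi>}. z' q t = z q t)))"
proof -
  have "invertible M"
    using mass_matrix_invertible[OF assms(2,3,10)] assms(11) by simp
  then show ?thesis
    using assms(14,15,17,18) by (intro semidiscrete_system_well_posed) auto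
qed

end
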